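(* Let $M=\operatorname{Mon}\langle X\mid R\rangle$ and $M'=\operatorname{Mon}\langle X'\mid R'\rangle$ be t-isomorphic tableau Garside monoids such that each of the two presentations satisfies the following two conditions, where $n$ is the number of generators: there are $n(n-1)/2$ defining relations; and if a word of length two in the generators appears as a side of a relation, then it appears only once. Let $(X,S)$ and $(X',S')$ be the non-degenerate, involutive and braided "set-theoretical" solutions defined by $M$ and $M'$ respectively. Then $(X,S)$ and $(X',S')$ are isomorphic.
   Context: A tableau monoid is a monoid $M=\operatorname{Mon}\langle X\mid R\rangle$, given with its presentation, such that $X=\{x_1,\dots,x_n\}$ is finite and each side of every relation in $R$ is a word of length $2$. Two tableau monoids $\operatorname{Mon}\langle X\mid R\rangle$ and $\operatorname{Mon}\langle X'\mid R'\rangle$ are t-isomorphic if there is a bijection $s:X\to X'$ such that $x_ix_j=x_kx_l$ is a relation in $R$ if and only if $s(x_i)s(x_j)=s(x_k)s(x_l)$ is a relation in $R'$. Garside monoids: $x$ is a left (resp. right) divisor of $z$ if $z=xt$ (resp. $z=tx$) for some $t$. Right lcms and left gcds are taken with respect to left divisibility, left lcms and right gcds with respect to right divisibility. A monoid is Garside if it is atomic (generated by its atoms, with a finite bound on the lengths of decompositions of each element into atoms), left and right cancellative, any two elements have left and right gcds and lcms, and it contains a Garside element, i.e. an element whose left divisors coincide with its right divisors, are finite in number, and generate the monoid. Solution defined by $M$: for a Garside tableau monoid with the two stated conditions, $S:X\times X\to X\times X$ is defined by $S(x_i,x_j)=(x_k,x_l)$ and $S(x_k,x_l)=(x_i,x_j)$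 if $x_ix_j=x_kx_l$ is a relation in $R$, and $S(x_i,x_j)=(x_i,x_j)$ if the word $x_ix_j$ is not a side of any relation in $R$. $S'$ is defined in the same way from $R'$. Write $S(x,y)=(S_1(x,y),S_2(x,y))=(g_x(y),f_y(x))$. $(X,S)$ is non-degenerate if all $f_x,g_x$ are bijective, involutive if $S^2=\mathrm{id}$, braided if $(S\times\mathrm{id})(\mathrm{id}\times S)(S\times\mathrm{id})=(\mathrm{id}\times S)(S\times\mathrm{id})(\mathrm{id}\times S)$ on $X^3$. Pairs $(X,S)$, $(X',S')$ are isomorphic if there is a bijection $\phi:X\to X'$ with $S'(\phi(x),\phi(y))=(\phi(S_1(x,y)),\phi(S_2(x,y)))$ for all $x,y\in X$. *)

theory Defs
  imports "HOL-Algebra.Divisibility"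
begin

section \<open>Monoid presentations\<close>

text \<open>A presentation is a set \<open>X\<close> of generators with a set \<open>R\<close> of relations; a pair \<open>(u, v) \<in> R\<close>
  stands for the relation \<open>u = v\<close> between words over \<open>X\<close>.\<close>

type_synonym 'a relations = "('a list \<times> 'a list) set"

text \<open>A relation is an equation, so the order in which its two sides are stored is irrelevant.\<close>

definition is_relation :: "'a relations \<Rightarrow> 'a list \<Rightarrow> 'a list \<Rightarrow> bool" where
  "is_relation R u v \<longleftrightarrow> (u, v) \<in> R \<or> (v, u) \<in> R"

definition sides :: "'a relations \<Rightarrow> 'a list set" where
  "sides R = fst ` R \<union> snd ` R"

inductive_set presentation_cong :: "'a set \<Rightarrow> 'a relations \<Rightarrow> 'a list rel"
  for X :: "'a set" and R :: "'a relations" where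
  rel: "(u, v) \<in> R \<Longrightarrow> (u, v) \<in> presentation_cong X R"
| refl: "u \<in> lists X \<Longrightarrow> (u, u) \<in> presentation_cong X R"
| sym: "(u, v) \<in> presentation_cong X R \<Longrightarrow> (v, u) \<in> presentation_cong X R"
| trans: "(u, v) \<in> presentation_cong X R \<Longrightarrow> (v, w) \<in> presentation_cong X R
          \<Longrightarrow> (u, w) \<in> presentation_cong X R"
| ctxt: "(u, v) \<in> presentation_cong X R \<Longrightarrow> a \<in> lists X \<Longrightarrow> b \<in> lists X
         \<Longrightarrow> (a @ u @ b, a @ v @ b) \<in> presentation_cong X R"

definition presented_monoid :: "'a set \<Rightarrow> 'a relations \<Rightarrow> 'a list set monoid" where
  "presented_monoid X R =
     \<lparr>carrier = lists X // presentation_cong X R,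
      mult = (\<lambda>A B. \<Union>u\<in>A. \<Union>v\<in>B. presentation_cong X R `` {u @ v}),
      one = presentation_cong X R `` {[]}\<rparr>"

lemma presentation_cong_equiv:
  assumes "R \<subseteq> lists X \<times> lists X"
  shows "equiv (lists X) (presentation_cong X R)"
proof (rule equivI)
  show "presentation_cong X R \<subseteq> lists X \<times> lists X"
  proof clarify
    fix u v assume "(u, v) \<in> presentation_cong X R"
    then show "u \<in> lists X \<and> v \<in> lists X"
      by induction (use assms in auto)
  qed
next
  show "refl_on (lists X) (presentation_cong X R)"
    by (rule refl_onI) (rule presentation_cong.refl)
  show "sym (presentation_cong X R)"
    by (rule symI) (rule presentation_cong.sym)
  show "trans (presentation_cong X R)"
    by (rule transI) (rule presentation_cong.trans)
qed

lemma presentation_cong_append: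
  assumes "R \<subseteq> lists X \<times> lists X"
    and "(u, u') \<in> presentation_cong X R" "(v, v') \<in> presentation_cong X R"
  shows "(u @ v, u' @ v') \<in> presentation_cong X R"
proof -
  have mem: "u' \<in> lists X" "v \<in> lists X"
    using equiv_type[OF presentation_cong_equiv[OF assms(1)]] assms(2,3) by blast+
  have "(u @ v, u' @ v) \<in> presentation_cong X R"
    using presentation_cong.ctxt[OF assms(2), of "[]" v] mem by simp
  moreover have "(u' @ v, u' @ v') \<in> presentation_cong X R"
    using presentation_cong.ctxt[OF assms(3), of u' "[]"] mem by simp
  ultimately show ?thesis
    by (rule presentation_cong.trans)
qed

lemma presented_monoid_mult:
  assumes "R \<subseteq> lists X \<times> lists X" "u \<in> lists X" "v \<in> lists X"
  shows "presentation_cong X R `` {u} \<otimes>\<^bsub>presented_monoid X R\<^esub> presentation_cong X R `` {v}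
    = presentation_cong X R `` {u @ v}"
proof -
  note eq = presentation_cong_equiv[OF assms(1)]
  have "presentation_cong X R `` {u' @ v'} = presentation_cong X R `` {u @ v}"
    if "(u, u') \<in> presentation_cong X R" "(v, v') \<in> presentation_cong X R" for u' v'
    using equiv_class_eq[OF eq presentation_cong_append[OF assms(1) that]] by simp
  moreover have "(u, u) \<in> presentation_cong X R" "(v, v) \<in> presentation_cong X R"
    using assms(2,3) by (simp_all only: presentation_cong.refl)
  ultimately have "(\<Union>u'\<in>presentation_cong X R `` {u}. \<Union>v'\<in>presentation_cong X R `` {v}.
      presentation_cong X R `` {u' @ v'}) = presentation_cong X R `` {u @ v}"
    by blast
  then show ?thesis
    by (simp add: presented_monoid_def)
qed

lemma presented_monoid_monoid:
  assumes "R \<subseteq> lists X \<times> lists X"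
  shows "monoid (presented_monoid X R)"
proof -
  let ?C = "\<lambda>u. presentation_cong X R `` {u}"
  let ?M = "presented_monoid X R"
  have car: "carrier ?M = ?C ` lists X" and one: "\<one>\<^bsub>?M\<^esub> = ?C []"
    by (auto simp: presented_monoid_def quotient_def)
  have mult: "?C u \<otimes>\<^bsub>?M\<^esub> ?C v = ?C (u @ v)" if "u \<in> lists X" "v \<in> lists X" for u v
    using presented_monoid_mult[OF assms that] .
  show ?thesis
  proof (rule monoidI)
    fix x y assume "x \<in> carrier ?M" "y \<in> carrier ?M"
    then obtain u v where "x = ?C u" "y = ?C v" "u \<in> lists X" "v \<in> lists X"
      unfolding car by blast
    then show "x \<otimes>\<^bsub>?M\<^esub> y \<in> carrier ?M"
      using mult[of u v] unfolding car by force
  next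
    show "\<one>\<^bsub>?M\<^esub> \<in> carrier ?M" unfolding car one by blast
  next
    fix x y z assume "x \<in> carrier ?M" "y \<in> carrier ?M" "z \<in> carrier ?M"
    then obtain u v w where *: "x = ?C u" "y = ?C v" "z = ?C w"
      "u \<in> lists X" "v \<in> lists X" "w \<in> lists X"
      unfolding car by blast
    then have "u @ v \<in> lists X" "v @ w \<in> lists X" by auto
    then show "x \<otimes>\<^bsub>?M\<^esub> y \<otimes>\<^bsub>?M\<^esub> z = x \<otimes>\<^bsub>?M\<^esub> (y \<otimes>\<^bsub>?M\<^esub> z)"
      using * by (simp add: mult)
  next
    fix x assume "x \<in> carrier ?M"
    then obtain u where *: "x = ?C u" "u \<in> lists X" unfolding car by blast
    then show "\<one>\<^bsub>?M\<^esub> \<otimes>\<^bsub>?M\<^esub> x = x" "x \<otimes>\<^bsub>?M\<^esub> \<one>\<^bsub>?M\<^esub> = x"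
      unfolding one using mult[of "[]" u] mult[of u "[]"] by auto
  qed
qed


section \<open>Garside monoids\<close>

text \<open>The library relation \<open>x divides\<^bsub>G\<^esub> z\<close> is left divisibility (\<open>z = x t\<close>), so \<open>gcdof\<^bsub>G\<^esub>\<close> is
  the left gcd and \<open>lcmof\<^bsub>G\<^esub>\<close> the right lcm. In the opposite monoid \<open>divides\<close> is right divisibility,
  and there \<open>gcdof\<close> is the right gcd of \<open>G\<close> and \<open>lcmof\<close> the left lcm of \<open>G\<close>.\<close>

definition opposite :: "('m, 'b) monoid_scheme \<Rightarrow> 'm monoid" where
  "opposite G = \<lparr>carrier = carrier G, mult = (\<lambda>x y. y \<otimes>\<^bsub>G\<^esub> x), one = \<one>\<^bsub>G\<^esub>\<rparr>"

definition left_divisors :: "('m, 'b) monoid_scheme \<Rightarrow> 'm \<Rightarrow> 'm set" where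
  "left_divisors G z = {x \<in> carrier G. x divides\<^bsub>G\<^esub> z}"

definition right_divisors :: "('m, 'b) monoid_scheme \<Rightarrow> 'm \<Rightarrow> 'm set" where
  "right_divisors G z = {x \<in> carrier G. x divides\<^bsub>opposite G\<^esub> z}"

definition list_prod :: "('m, 'b) monoid_scheme \<Rightarrow> 'm list \<Rightarrow> 'm" where
  "list_prod G xs = foldr (\<otimes>\<^bsub>G\<^esub>) xs \<one>\<^bsub>G\<^esub>"

definition generates :: "('m, 'b) monoid_scheme \<Rightarrow> 'm set \<Rightarrow> bool" where
  "generates G A \<longleftrightarrow> A \<subseteq> carrier G \<and> (\<forall>x\<in>carrier G. \<exists>xs. set xs \<subseteq> A \<and> list_prod G xs = x)"

definition atoms :: "('m, 'b) monoid_scheme \<Rightarrow> 'm set" where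
  "atoms G = {a \<in> carrier G. a \<noteq> \<one>\<^bsub>G\<^esub> \<and>
     (\<forall>b\<in>carrier G. \<forall>c\<in>carrier G. a = b \<otimes>\<^bsub>G\<^esub> c \<longrightarrow> b = \<one>\<^bsub>G\<^esub> \<or> c = \<one>\<^bsub>G\<^esub>)}"

definition atomic :: "('m, 'b) monoid_scheme \<Rightarrow> bool" where
  "atomic G \<longleftrightarrow> generates G (atoms G) \<and>
     (\<forall>x\<in>carrier G. \<exists>N::nat. \<forall>xs. set xs \<subseteq> atoms G \<and> list_prod G xs = x \<longrightarrow> length xs \<le> N)"

definition garside_element :: "('m, 'b) monoid_scheme \<Rightarrow> 'm \<Rightarrow> bool" where
  "garside_element G d \<longleftrightarrow> d \<in> carrier G \<and> left_divisors G d = right_divisors G d \<and>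
     finite (left_divisors G d) \<and> generates G (left_divisors G d)"

definition garside :: "('m, 'b) monoid_scheme \<Rightarrow> bool" where
  "garside G \<longleftrightarrow> monoid_cancel G \<and> atomic G \<and>
     (\<forall>x\<in>carrier G. \<forall>y\<in>carrier G.
        (\<exists>z\<in>carrier G. z gcdof\<^bsub>G\<^esub> x y) \<and> (\<exists>z\<in>carrier G. z lcmof\<^bsub>G\<^esub> x y) \<and>
        (\<exists>z\<in>carrier G. z gcdof\<^bsub>opposite G\<^esub> x y) \<and> (\<exists>z\<in>carrier G. z lcmof\<^bsub>opposite G\<^esub> x y)) \<and>
     (\<exists>d. garside_element G d)"


section \<open>Tableau monoids\<close>

definition tableau :: "'a set \<Rightarrow> 'a relations \<Rightarrow> bool" where
  "tableau X R \<longleftrightarrow> finite X \<and>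
     (\<forall>(u, v)\<in>R. u \<in> lists X \<and> v \<in> lists X \<and> length u = 2 \<and> length v = 2)"

definition t_isomorphic :: "'a set \<Rightarrow> 'a relations \<Rightarrow> 'b set \<Rightarrow> 'b relations \<Rightarrow> bool" where
  "t_isomorphic X R X' R' \<longleftrightarrow> (\<exists>s. bij_betw s X X' \<and>
     (\<forall>i\<in>X. \<forall>j\<in>X. \<forall>k\<in>X. \<forall>l\<in>X.
        is_relation R [i, j] [k, l] \<longleftrightarrow> is_relation R' [s i, s j] [s k, s l]))"

text \<open>Occurrences of a word are counted over both sides of all relations; in particular a word
  occurring once rules out a trivial relation \<open>w = w\<close> and listing a relation in both orders.\<close>

definition num_occurrences :: "'a relations \<Rightarrow> 'a list \<Rightarrow> nat" where
  "num_occurrences R w = card {r \<in> R. fst r = w} + card {r \<in> R. snd r = w}"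

definition presentation_conditions :: "'a set \<Rightarrow> 'a relations \<Rightarrow> bool" where
  "presentation_conditions X R \<longleftrightarrow>
     card R = card X * (card X - 1) div 2 \<and> (\<forall>w \<in> sides R. num_occurrences R w = 1)"


section \<open>Set-theoretical solutions\<close>

text \<open>In the notation \<open>S (x, y) = (g\<^sub>x y, f\<^sub>y x)\<close>, the two bijectivity conditions are those on
  \<open>g\<^sub>x\<close> and \<open>f\<^sub>y\<close>.\<close>

definition nondegenerate :: "'a set \<Rightarrow> ('a \<times> 'a \<Rightarrow> 'a \<times> 'a) \<Rightarrow> bool" where
  "nondegenerate X S \<longleftrightarrow>
     (\<forall>x\<in>X. bij_betw (\<lambda>y. fst (S (x, y))) X X) \<and>
     (\<forall>y\<in>X. bij_betw (\<lambda>x. snd (S (x, y))) X X)"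

definition involutive :: "'a set \<Rightarrow> ('a \<times> 'a \<Rightarrow> 'a \<times> 'a) \<Rightarrow> bool" where
  "involutive X S \<longleftrightarrow> (\<forall>p\<in>X \<times> X. S (S p) = p)"

definition on_first_two :: "('a \<times> 'a \<Rightarrow> 'a \<times> 'a) \<Rightarrow> 'a \<times> 'a \<times> 'a \<Rightarrow> 'a \<times> 'a \<times> 'a" where
  "on_first_two S = (\<lambda>(x, y, z). (fst (S (x, y)), snd (S (x, y)), z))"

definition on_last_two :: "('a \<times> 'a \<Rightarrow> 'a \<times> 'a) \<Rightarrow> 'a \<times> 'a \<times> 'a \<Rightarrow> 'a \<times> 'a \<times> 'a" where
  "on_last_two S = (\<lambda>(x, y, z). (x, S (y, z)))"

definition braided :: "'a set \<Rightarrow> ('a \<times> 'a \<Rightarrow> 'a \<times> 'a) \<Rightarrow> bool" where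
  "braided X S \<longleftrightarrow> (\<forall>t \<in> X \<times> X \<times> X.
     on_first_two S (on_last_two S (on_first_two S t)) =
     on_last_two S (on_first_two S (on_last_two S t)))"

text \<open>The conditions determine \<open>S\<close> on \<open>X \<times> X\<close>; its values elsewhere are irrelevant throughout.\<close>

definition solution_defined_by ::
  "'a set \<Rightarrow> 'a relations \<Rightarrow> ('a \<times> 'a \<Rightarrow> 'a \<times> 'a) \<Rightarrow> bool" where
  "solution_defined_by X R S \<longleftrightarrow>
     S \<in> X \<times> X \<rightarrow> X \<times> X \<and>
     (\<forall>i\<in>X. \<forall>j\<in>X. \<forall>k\<in>X. \<forall>l\<in>X. is_relation R [i, j] [k, l] \<longrightarrow>
        S (i, j) = (k, l) \<and> S (k, l) = (i, j)) \<and>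
     (\<forall>i\<in>X. \<forall>j\<in>X. [i, j] \<notin> sides R \<longrightarrow> S (i, j) = (i, j))"

definition isomorphic_solutions ::
  "'a set \<Rightarrow> ('a \<times> 'a \<Rightarrow> 'a \<times> 'a) \<Rightarrow> 'b set \<Rightarrow> ('b \<times> 'b \<Rightarrow> 'b \<times> 'b) \<Rightarrow> bool" where
  "isomorphic_solutions X S X' S' \<longleftrightarrow> (\<exists>\<phi>. bij_betw \<phi> X X' \<and>
     (\<forall>x\<in>X. \<forall>y\<in>X. S' (\<phi> x, \<phi> y) = (\<phi> (fst (S (x, y))), \<phi> (snd (S (x, y))))))"

end

theory Submission
  imports Defs
begin

text \<open>The solution attached to a tableau presentation is read off from its relations alone, so the
  bijection \<open>s\<close> that witnesses t-isomorphism is itself the isomorphism of solutions. On a pair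
  \<open>(x, y)\<close> whose word is a side of a relation, \<open>s\<close> carries the relation that determines
  \<open>S (x, y)\<close> to the one that determines \<open>S' (s x, s y)\<close>. On the remaining pairs \<open>S\<close> is the
  identity, and so is \<open>S'\<close> on their images: by surjectivity of \<open>s\<close>, a relation of \<open>R'\<close>
  involving \<open>s x s y\<close> has a second side of the form \<open>s k s l\<close>, hence comes from a relation of
  \<open>R\<close> involving \<open>x y\<close> (\<open>bij_preserves_sides\<close>).\<close>

lemma tableau_side_iff:
  assumes "tableau X R"
  shows "[i, j] \<in> sides R \<longleftrightarrow> (\<exists>k\<in>X. \<exists>l\<in>X. is_relation R [i, j] [k, l])"
proof
  have len2: "\<exists>k\<in>X. \<exists>l\<in>X. w = [k, l]" if "w \<in> lists X" "length w = 2" for w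
    using that by (auto simp: length_Suc_conv numeral_2_eq_2)
  assume "[i, j] \<in> sides R"
  then obtain w where w: "is_relation R [i, j] w"
    unfolding sides_def is_relation_def by force
  then have "w \<in> lists X" "length w = 2"
    using assms unfolding tableau_def is_relation_def by auto
  then show "\<exists>k\<in>X. \<exists>l\<in>X. is_relation R [i, j] [k, l]"
    using len2 w by blast
next
  assume "\<exists>k\<in>X. \<exists>l\<in>X. is_relation R [i, j] [k, l]"
  then show "[i, j] \<in> sides R"
    unfolding sides_def is_relation_def by force
qed

text \<open>The hypothesis on \<open>s\<close> speaks of relations, that is, of pairs of words; surjectivity of \<open>s\<close>
  is what allows the second word of the pair to be forgotten.\<close>

lemma bij_preserves_sides:
  assumes "tableau X R" "tableau X' R'" "bij_betw s X X'"
    and "\<forall>i\<in>X. \<forall>j\<in>X. \<forall>k\<in>X. \<forall>l\<in>X.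
      is_relation R [i, j] [k, l] \<longleftrightarrow> is_relation R' [s i, s j] [s k, s l]"
    and "i \<in> X" "j \<in> X"
  shows "[s i, s j] \<in> sides R' \<longleftrightarrow> [i, j] \<in> sides R"
proof -
  have "X' = s ` X"
    using assms(3) by (simp add: bij_betw_def)
  then show ?thesis
    using assms(4-6) by (simp add: tableau_side_iff[OF assms(1)] tableau_side_iff[OF assms(2)])
qed

theorem claim8p13:
  fixes X :: "'a set" and R :: "'a relations" and S :: "'a \<times> 'a \<Rightarrow> 'a \<times> 'a"
    and X' :: "'b set" and R' :: "'b relations" and S' :: "'b \<times> 'b \<Rightarrow> 'b \<times> 'b"
  assumes "tableau X R" and "garside (presented_monoid X R)"
    and "presentation_conditions X R"
    and "tableau X' R'" and "garside (presented_monoid X' R')"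
    and "presentation_conditions X' R'"
    and "t_isomorphic X R X' R'"
    and "solution_defined_by X R S"
    and "nondegenerate X S" and "involutive X S" and "braided X S"
    and "solution_defined_by X' R' S'"
    and "nondegenerate X' S'" and "involutive X' S'" and "braided X' S'"
  shows "isomorphic_solutions X S X' S'"
proof -
  obtain s where s: "bij_betw s X X'"
    and rel: "\<forall>i\<in>X. \<forall>j\<in>X. \<forall>k\<in>X. \<forall>l\<in>X.
      is_relation R [i, j] [k, l] \<longleftrightarrow> is_relation R' [s i, s j] [s k, s l]"
    using \<open>t_isomorphic X R X' R'\<close> unfolding t_isomorphic_def by blast
  have sX: "s x \<in> X'" if "x \<in> X" for x
    using s that by (rule bij_betwE[rule_format])
  have "S' (s x, s y) = (s (fst (S (x, y))), s (snd (S (x, y))))"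
    if xy: "x \<in> X" "y \<in> X" for x y
  proof (cases "[x, y] \<in> sides R")
    case True
    then obtain k l where kl: "k \<in> X" "l \<in> X" and r: "is_relation R [x, y] [k, l]"
      using tableau_side_iff[OF \<open>tableau X R\<close>] by blast
    have "S (x, y) = (k, l)"
      using \<open>solution_defined_by X R S\<close> xy kl r unfolding solution_defined_by_def by blast
    moreover have "is_relation R' [s x, s y] [s k, s l]"
      using rel xy kl r by blast
    then have "S' (s x, s y) = (s k, s l)"
      using \<open>solution_defined_by X' R' S'\<close> sX xy kl unfolding solution_defined_by_def by blast
    ultimately show ?thesis by simp
  next
    case False
    then have "[s x, s y] \<notin> sides R'"
      using bij_preserves_sides[OF \<open>tableau X R\<close> \<open>tableau X' R'\<close> s rel xy] by simp
    then have "S' (s x, s y) = (s x, s y)"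
      using \<open>solution_defined_by X' R' S'\<close> sX xy unfolding solution_defined_by_def by blast
    moreover have "S (x, y) = (x, y)"
      using \<open>solution_defined_by X R S\<close> xy False unfolding solution_defined_by_def by blast
    ultimately show ?thesis by simp
  qed
  then show ?thesis
    using s unfolding isomorphic_solutions_def by blast
qed

end
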